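(* Let $E\subseteq\mathbb R^2$ be a compact set. If there exist $y,y'\in \mathbb R^2$ with $y\ne y'$ and $\mathcal{L}^1(\Delta_y(E))=\mathcal{L}^1(\Delta_{y'}(E))=0$, then $E$ is purely $1$-unrectifiable.
   Context: For $y\in\mathbb R^2$, the pinned distance set of $E$ at $y$ is $\Delta_y(E):=\{|x-y|:x\in E\}$. $\mathcal L^1$ is Lebesgue measure on $\mathbb R$ and $\mathcal H^1$ is $1$-dimensional Hausdorff measure. A set $\zeta\subseteq\mathbb R^2$ is a Lipschitz graph if there exist a Lipschitz function $F:\mathbb R\to\mathbb R$ and an orthonormal pair $\omega_1,\omega_2\in S^1$ such that $\zeta=\{x\omega_1+F(x)\omega_2:x\in\mathbb R\}$. A set $E\subseteq\mathbb R^2$ is purely $1$-unrectifiable if $\mathcal H^1(E\cap\zeta)=0$ for every Lipschitz graph $\zeta\subseteq\mathbb R^2$. *)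

theory Defs
  imports "HOL-Analysis.Analysis"
begin

definition pinned_distance_set :: "real ^ 2 \<Rightarrow> (real ^ 2) set \<Rightarrow> real set" where
  "pinned_distance_set y E = {norm (x - y) | x. x \<in> E}"

text \<open>One-dimensional Hausdorff (outer) measure, obtained from countable covers by sets of
  diameter at most \<open>\<delta>\<close> by letting \<open>\<delta>\<close> tend to 0; the supremum is that limit, because the
  infimum grows as \<open>\<delta>\<close> decreases. Covering sets must be bounded explicitly, since
  \<^const>\<open>diameter\<close> is real-valued and has no meaningful value on unbounded sets. In dimension
  one the usual normalising constant is 1.\<close>

definition hausdorff_measure1_delta :: "real \<Rightarrow> 'a::metric_space set \<Rightarrow> ennreal" where
  "hausdorff_measure1_delta \<delta> A =
     (INF U \<in> {U :: nat \<Rightarrow> 'a set.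
                 A \<subseteq> (\<Union>i. U i) \<and> (\<forall>i. bounded (U i) \<and> diameter (U i) \<le> \<delta>)}.
        \<Sum>i. ennreal (diameter (U i)))"

definition hausdorff_measure1 :: "'a::metric_space set \<Rightarrow> ennreal" where
  "hausdorff_measure1 A = (SUP \<delta> \<in> {0<..}. hausdorff_measure1_delta \<delta> A)"

definition lipschitz_graph :: "(real ^ 2) set \<Rightarrow> bool" where
  "lipschitz_graph Z \<longleftrightarrow>
     (\<exists>(F :: real \<Rightarrow> real) L w1 w2.
        L-lipschitz_on UNIV F \<and> norm w1 = 1 \<and> norm w2 = 1 \<and> w1 \<bullet> w2 = 0 \<and>
        Z = {x *\<^sub>R w1 + F x *\<^sub>R w2 | x. x \<in> UNIV})"

definition purely_1_unrectifiable :: "(real ^ 2) set \<Rightarrow> bool" where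
  "purely_1_unrectifiable E \<longleftrightarrow>
     (\<forall>Z. lipschitz_graph Z \<longrightarrow> hausdorff_measure1 (E \<inter> Z) = 0)"

end

theory Submission imports Defs begin

text \<open>Parametrise a Lipschitz graph by \<open>\<gamma>\<close> and let \<open>T\<close> be the set of parameters landing in \<open>E\<close>; it
  suffices that \<open>T\<close> is null. No differentiability is needed: if \<open>f\<close> is \<open>L\<close>-Lipschitz and \<open>f(T)\<close> is
  null, then by the intermediate value theorem the increment of \<open>f\<close> over an interval \<open>I\<close> is at most
  a constant times \<open>L |I - T|\<close>. Hence if two such functions jointly control the parameter, then
  \<open>|I| \<le> C |I - T|\<close> for all intervals \<open>I\<close>, and covering \<open>T\<close> efficiently by nonoverlapping intervals
  gives \<open>|T| = 0\<close>. Off the line through the two pins the distances to the pins are such a pair,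
  and on the line the Cartesian coordinates along and across it are.\<close>

section \<open>Interval covers and Lipschitz functions on the line\<close>

text \<open>Two nonoverlapping boxes meet in a convex set with empty interior, hence in a null set,
  so measures add. Subtracting \<open>S\<close> lets one fact serve both covers
  (\<open>S = {}\<close>) and their excess over a set.\<close>

lemma measure_finite_Union_nonoverlapping_cboxes:
  fixes \<D> :: "'a::euclidean_space set set"
  assumes "finite \<D>"
    and cbox: "\<And>K. K \<in> \<D> \<Longrightarrow> \<exists>u v. K = cbox u v"
    and disj: "pairwise (\<lambda>A B. interior A \<inter> interior B = {}) \<D>"
    and S: "S \<in> sets lebesgue"
  shows "measure lebesgue (\<Union>\<D> - S) = (\<Sum>K\<in>\<D>. measure lebesgue (K - S))"
proof -
  have "measure lebesgue (\<Union>K\<in>\<D>. K - S) = (\<Sum>K\<in>\<D>. measure lebesgue (K - S))"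
  proof (rule measure_negligible_finite_Union_image[OF \<open>finite \<D>\<close>])
    show "K - S \<in> lmeasurable" if "K \<in> \<D>" for K
      using cbox[OF that] S fmeasurable_Diff by blast
    have "negligible (A \<inter> B)" if AB: "A \<in> \<D>" "B \<in> \<D>" "A \<noteq> B" for A B
    proof -
      have "convex (A \<inter> B)"
        using cbox AB by (metis convex_Int convex_box(1))
      moreover have "interior (A \<inter> B) = {}"
        using disj AB by (simp add: pairwise_def)
      ultimately show ?thesis
        by (simp add: negligible_convex_interior)
    qed
    then show "pairwise (\<lambda>A B. negligible ((A - S) \<inter> (B - S))) \<D>"
      unfolding pairwise_def by (meson Diff_subset Int_mono negligible_subset)
  qed
  moreover have "(\<Union>K\<in>\<D>. K - S) = \<Union>\<D> - S"
    by blast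
  ultimately show ?thesis
    by simp
qed

text \<open>Nonoverlapping intervals of total length close to the measure of \<open>S\<close> cover
  \<open>S\<close>, and the image of each lies in a ball of length \<open>2 * L\<close> times its
  own. Covering by balls avoids any question about measurability of the image of
  \<open>S\<close>.\<close>

lemma interval_length_le_lipschitz_image:
  fixes f :: "real \<Rightarrow> real"
  assumes f: "L-lipschitz_on {a..b} f" and S: "S \<in> lmeasurable" "S \<subseteq> {a..b}"
    and N: "negligible N" and sub: "{c..d} \<subseteq> N \<union> f ` S"
  shows "d - c \<le> 2 * L * measure lebesgue S"
proof (rule field_le_epsilon)
  fix e :: real
  assume "e > 0"
  have L: "L \<ge> 0"
    using f lipschitz_on_nonneg by blast
  \<comment> \<open>The summand 1 keeps the denominator positive when \<open>L = 0\<close>.\<close>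
  define e' where "e' = e / (2 * L + 1)"
  have e': "e' > 0" "2 * L * e' \<le> e"
    using \<open>e > 0\<close> L by (auto simp: e'_def field_simps)
  obtain \<D> where \<D>: "countable \<D>"
      "\<And>K. K \<in> \<D> \<Longrightarrow> K \<subseteq> cbox a b \<and> K \<noteq> {} \<and> (\<exists>c d. K = cbox c d)"
      "pairwise (\<lambda>A B. interior A \<inter> interior B = {}) \<D>"
      "S \<subseteq> \<Union>\<D>" "\<Union>\<D> \<in> lmeasurable" "measure lebesgue (\<Union>\<D>) \<le> measure lebesgue S + e'"
    using measurable_outer_intervals_bounded[of S a b e'] S e' by (metis box_real(2))
  \<comment> \<open>\<open>Inf K\<close> is the left endpoint of \<open>K\<close>. Using the whole
    ball around its image costs the factor 2.\<close>
  define B where "B K = cball (f (Inf K)) (L * measure lebesgue K)" for K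
  have fB: "f ` K \<subseteq> B K" if "K \<in> \<D>" for K
  proof -
    obtain u v where K: "K = {u..v}" "u \<le> v" "{u..v} \<subseteq> {a..b}"
      using \<D>(2) \<open>K \<in> \<D>\<close> by (metis box_real(2) atLeastatMost_empty_iff)
    have "dist (f u) (f x) \<le> L * (v - u)" if "x \<in> {u..v}" for x
    proof -
      have "dist (f u) (f x) \<le> L * dist u x"
        using lipschitz_onD[OF f] K that by auto
      also have "\<dots> \<le> L * (v - u)"
        using that L by (auto simp: dist_real_def intro!: mult_left_mono)
      finally show ?thesis .
    qed
    then show ?thesis
      using K by (auto simp: B_def)
  qed
  have mB: "B K \<in> lmeasurable" "measure lebesgue (B K) = 2 * L * measure lebesgue K" for K
    using L by (auto simp: B_def cball_eq_atLeastAtMost)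
  \<comment> \<open>A bound uniform over finite subfamilies passes to the countable union and also
    yields its finite measure.\<close>
  have bound: "measure lebesgue (\<Union>K\<in>\<F>. B K) \<le> 2 * L * (measure lebesgue S + e')"
    if \<F>: "\<F> \<subseteq> \<D>" "finite \<F>" for \<F>
  proof -
    have cb: "\<And>K. K \<in> \<F> \<Longrightarrow> \<exists>c d. K = cbox c d"
        "pairwise (\<lambda>A B. interior A \<inter> interior B = {}) \<F>"
      using \<F> \<D>(2) pairwise_subset[OF \<D>(3)] by blast+
    have "measure lebesgue (\<Union>K\<in>\<F>. B K) \<le> (\<Sum>K\<in>\<F>. measure lebesgue (B K))"
      using \<F> mB by (intro measure_UNION_le) (auto simp: fmeasurableD)
    also have "\<dots> = 2 * L * measure lebesgue (\<Union>\<F>)"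
      using measure_finite_Union_nonoverlapping_cboxes[OF \<F>(2) cb, of "{}"]
      by (simp add: mB sum_distrib_left)
    also have "\<dots> \<le> 2 * L * measure lebesgue (\<Union>\<D>)"
      using L \<F> \<D>(5)
      by (intro mult_left_mono measure_mono_fmeasurable Union_mono sets.finite_Union)
        (auto dest!: cb(1))
    also have "\<dots> \<le> 2 * L * (measure lebesgue S + e')"
      using \<D>(6) L by (intro mult_left_mono) auto
    finally show ?thesis .
  qed
  have UB: "(\<Union>K\<in>\<D>. B K) \<in> lmeasurable" "measure lebesgue (\<Union>K\<in>\<D>. B K) \<le> 2 * L * (measure lebesgue S + e')"
    using fmeasurable_UN_bound[OF \<D>(1) mB(1) bound] measure_UN_bound[OF \<D>(1) mB(1) bound] by auto
  have "{c..d} \<subseteq> N \<union> (\<Union>K\<in>\<D>. B K)"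
    using sub \<D>(4) fB by blast
  then have "measure lebesgue {c..d} \<le> measure lebesgue (N \<union> (\<Union>K\<in>\<D>. B K))"
    using N UB by (intro measure_mono_fmeasurable) (auto simp: negligible_imp_measurable intro: fmeasurable.Un)
  also have "\<dots> \<le> measure lebesgue N + measure lebesgue (\<Union>K\<in>\<D>. B K)"
    using N UB by (intro measure_Un_le) (auto simp: negligible_imp_measurable fmeasurableD negligible_imp_sets)
  also have "\<dots> \<le> 2 * L * (measure lebesgue S + e')"
    using UB N by (simp add: negligible_imp_measure0)
  also have "\<dots> \<le> 2 * L * measure lebesgue S + e"
    using e' by (simp add: algebra_simps)
  \<comment> \<open>For \<open>c > d\<close> the interval is empty, but then \<open>d - c\<close> is
    negative and the right-hand side is nonnegative.\<close>
  finally show "d - c \<le> 2 * L * measure lebesgue S + e"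
    by (cases "c \<le> d") (use L \<open>e > 0\<close> in \<open>auto intro: order_trans[of _ 0]\<close>)
qed

text \<open>The interval between \<open>f u\<close> and \<open>f v\<close> lies in the image of
  \<open>{u..v}\<close>; what \<open>T\<close> contributes to it is null, so only
  \<open>{u..v} - T\<close> pays for the increment.\<close>

lemma lipschitz_increment_le_measure_Diff:
  fixes f :: "real \<Rightarrow> real"
  assumes f: "L-lipschitz_on {a..b} f" and T: "T \<in> sets lebesgue" and N: "negligible (f ` T)"
    and uv: "a \<le> u" "u \<le> v" "v \<le> b"
  shows "\<bar>f v - f u\<bar> \<le> 2 * L * measure lebesgue ({u..v} - T)"
proof -
  have "continuous_on {u..v} f"
    using lipschitz_on_continuous_on[OF f] uv by (auto intro: continuous_on_subset)
  then have "connected (f ` {u..v})"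
    by (intro connected_continuous_image) auto
  then have "{min (f u) (f v)..max (f u) (f v)} \<subseteq> f ` {u..v}"
    using uv by (intro connected_contains_Icc) (auto simp: min_def max_def)
  also have "\<dots> \<subseteq> f ` T \<union> f ` ({u..v} - T)"
    by blast
  finally have "max (f u) (f v) - min (f u) (f v) \<le> 2 * L * measure lebesgue ({u..v} - T)"
    using uv by (intro interval_length_le_lipschitz_image[OF f _ _ N] fmeasurable_Diff T) auto
  then show ?thesis
    by (auto simp: max_def min_def abs_if split: if_splits)
qed

text \<open>No interval can be almost filled by \<open>T\<close>, since its length is at most
  \<open>C\<close> times the part outside \<open>T\<close>. Summed over a nearly optimal cover, this
  bounds the measure of \<open>T\<close> by \<open>C\<close> times the excess of the cover; no
  density points are needed.\<close>

lemma negligible_if_lipschitz_images_negligible: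
  fixes f g :: "real \<Rightarrow> real"
  assumes f: "L-lipschitz_on {a..b} f" and g: "L-lipschitz_on {a..b} g"
    and T: "T \<in> sets lebesgue" "T \<subseteq> {a..b}"
    and neg: "negligible (f ` T)" "negligible (g ` T)"
    and sep: "\<And>s t. s \<in> {a..b} \<Longrightarrow> t \<in> {a..b} \<Longrightarrow> \<bar>t - s\<bar> \<le> M * (\<bar>f t - f s\<bar> + \<bar>g t - g s\<bar>)"
    and M: "M \<ge> 0"
  shows "negligible T"
proof -
  have L: "L \<ge> 0"
    using f lipschitz_on_nonneg by blast
  have Tm: "T \<in> lmeasurable"
    using T by (metis bounded_closed_interval bounded_set_imp_lmeasurable bounded_subset)
  \<comment> \<open>Each of \<open>f\<close> and \<open>g\<close> contributes \<open>2 * L\<close>,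
    and \<open>sep\<close> the factor \<open>M\<close>.\<close>
  define C where "C = 4 * M * L"
  have C: "C \<ge> 0"
    using M L by (simp add: C_def)
  have K: "measure lebesgue {u..v} \<le> C * measure lebesgue ({u..v} - T)" if uv: "a \<le> u" "u \<le> v" "v \<le> b" for u v
  proof -
    have "v - u \<le> M * (\<bar>f v - f u\<bar> + \<bar>g v - g u\<bar>)"
      using sep[of u v] uv by auto
    also have "\<dots> \<le> M * (2 * L * measure lebesgue ({u..v} - T) + 2 * L * measure lebesgue ({u..v} - T))"
      using lipschitz_increment_le_measure_Diff[OF f T(1) neg(1) uv]
        lipschitz_increment_le_measure_Diff[OF g T(1) neg(2) uv]
      by (intro mult_left_mono M) linarith
    finally show ?thesis
      using uv by (simp add: C_def algebra_simps)
  qed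
  have le: "measure lebesgue T \<le> 0 + e" if "e > 0" for e
  proof -
    define e' where "e' = e / (C + 1)"
    have e': "e' > 0" "C * e' \<le> e"
      using \<open>e > 0\<close> C by (auto simp: e'_def field_simps)
    obtain \<D> where \<D>: "countable \<D>"
        "\<And>K. K \<in> \<D> \<Longrightarrow> K \<subseteq> cbox a b \<and> K \<noteq> {} \<and> (\<exists>c d. K = cbox c d)"
        "pairwise (\<lambda>A B. interior A \<inter> interior B = {}) \<D>"
        "T \<subseteq> \<Union>\<D>" "\<Union>\<D> \<in> lmeasurable" "measure lebesgue (\<Union>\<D>) \<le> measure lebesgue T + e'"
      using measurable_outer_intervals_bounded[of T a b e'] Tm T e' by (metis box_real(2))
    have meas: "K \<in> lmeasurable" if "K \<in> \<D>" for K
      using \<D>(2)[OF that] by auto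
    have bound: "measure lebesgue (\<Union>K\<in>\<F>. K) \<le> C * e'" if \<F>: "\<F> \<subseteq> \<D>" "finite \<F>" for \<F>
    proof -
      have cb: "\<And>K. K \<in> \<F> \<Longrightarrow> \<exists>c d. K = cbox c d"
          "pairwise (\<lambda>A B. interior A \<inter> interior B = {}) \<F>"
        using \<F> \<D>(2) pairwise_subset[OF \<D>(3)] by blast+
      have "measure lebesgue (\<Union>K\<in>\<F>. K) \<le> (\<Sum>K\<in>\<F>. measure lebesgue K)"
        using \<F> meas by (intro measure_UNION_le) (auto simp: fmeasurableD)
      also have "\<dots> \<le> (\<Sum>K\<in>\<F>. C * measure lebesgue (K - T))"
      proof (rule sum_mono)
        fix K assume "K \<in> \<F>"
        then obtain u v where "K = {u..v}" "u \<le> v" "{u..v} \<subseteq> {a..b}"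
          using \<D>(2) \<F> by (metis box_real(2) atLeastatMost_empty_iff subsetD)
        then show "measure lebesgue K \<le> C * measure lebesgue (K - T)"
          using K[of u v] by auto
      qed
      also have "\<dots> = C * measure lebesgue (\<Union>\<F> - T)"
        using measure_finite_Union_nonoverlapping_cboxes[OF \<F>(2) cb T(1)]
        by (simp add: sum_distrib_left)
      also have "\<dots> \<le> C * measure lebesgue (\<Union>\<D> - T)"
        using C \<F> \<D>(5) T meas
        by (intro mult_left_mono measure_mono_fmeasurable fmeasurable_Diff sets.Diff sets.finite_Union)
          (auto simp: fmeasurableD)
      \<comment> \<open>As \<open>T\<close> lies inside the cover, this is the excess of the cover,
        at most \<open>e'\<close>.\<close>
      also have "measure lebesgue (\<Union>\<D> - T) = measure lebesgue (\<Union>\<D>) - measure lebesgue T"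
        using \<D>(4,5) Tm by (intro measurable_measure_Diff) (auto simp: fmeasurableD)
      also have "C * \<dots> \<le> C * e'"
        using \<D>(6) C by (intro mult_left_mono) auto
      finally show ?thesis .
    qed
    have "measure lebesgue T \<le> measure lebesgue (\<Union>\<D>)"
      using \<D>(4,5) T by (intro measure_mono_fmeasurable) auto
    also have "\<dots> \<le> C * e'"
      using measure_UN_bound[of \<D> "\<lambda>K. K" lebesgue, OF \<D>(1) meas bound] by simp
    finally show ?thesis
      using e' by simp
  qed
  have "measure lebesgue T = 0"
    using field_le_epsilon[OF le] by (simp add: order_antisym)
  then show ?thesis
    using Tm negligible_iff_measure by blast
qed

section \<open>Hausdorff measure of Lipschitz images\<close>

text \<open>A null set has interval covers of arbitrarily small total length, and \<open>f\<close>
  turns lengths into diameters at most \<open>C\<close> times as large.\<close>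

lemma hausdorff_measure1_lipschitz_image_eq_0:
  fixes f :: "real \<Rightarrow> 'a::real_normed_vector"
  assumes f: "C-lipschitz_on UNIV f" and T: "negligible T" "T \<subseteq> {a..b}"
  shows "hausdorff_measure1 (f ` T) = 0"
proof -
  have C: "C \<ge> 0"
    using f lipschitz_on_nonneg by blast
  have small: "hausdorff_measure1_delta \<delta> (f ` T) \<le> ennreal \<epsilon>" if "\<delta> > 0" "\<epsilon> > 0" for \<delta> \<epsilon>
  proof -
    \<comment> \<open>One \<open>e\<close> serves both demands: \<open>C * e\<close> bounds the sum
      of the diameters, and therefore each single diameter.\<close>
    define e where "e = min \<delta> \<epsilon> / (C + 1)"
    have e: "e > 0" "C * e \<le> \<delta>" "C * e \<le> \<epsilon>"
    proof -
      show "e > 0"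
        using that C by (simp add: e_def)
      then have "C * e \<le> (C + 1) * e"
        by (simp add: distrib_right)
      also have "\<dots> = min \<delta> \<epsilon>"
        using C by (simp add: e_def)
      finally show "C * e \<le> \<delta>" "C * e \<le> \<epsilon>"
        by auto
    qed
    obtain \<D> where \<D>: "countable \<D>"
        "\<And>K. K \<in> \<D> \<Longrightarrow> K \<subseteq> cbox a b \<and> K \<noteq> {} \<and> (\<exists>c d. K = cbox c d)"
        "pairwise (\<lambda>A B. interior A \<inter> interior B = {}) \<D>"
        "T \<subseteq> \<Union>\<D>" "\<Union>\<D> \<in> lmeasurable" "measure lebesgue (\<Union>\<D>) \<le> measure lebesgue T + e"
      using measurable_outer_intervals_bounded[of T a b e] T e
      by (metis box_real(2) negligible_imp_measurable)
    have UD: "measure lebesgue (\<Union>\<D>) \<le> e"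
      using \<D>(6) T by (simp add: negligible_imp_measure0)
    have img: "bounded (f ` K)" "diameter (f ` K) \<le> C * measure lebesgue K" if "K \<in> \<D>" for K
    proof -
      obtain u v where K: "K = {u..v}" "u \<le> v"
        using \<D>(2) \<open>K \<in> \<D>\<close> by (metis box_real(2) atLeastatMost_empty_iff)
      have "norm (f x - f y) \<le> C * (v - u)" if "x \<in> K" "y \<in> K" for x y
      proof -
        have "norm (f x - f y) \<le> C * \<bar>x - y\<bar>"
          using lipschitz_on_normD[OF f] by auto
        also have "\<dots> \<le> C * (v - u)"
          using that K C by (intro mult_left_mono) auto
        finally show ?thesis .
      qed
      then have "diameter (f ` K) \<le> C * (v - u)"
        using K by (intro diameter_le) auto
      then show "diameter (f ` K) \<le> C * measure lebesgue K"
        using K by simp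
      have "compact (f ` K)"
        using K lipschitz_on_continuous_on[OF f] 
        by (intro compact_continuous_image) (auto intro: continuous_on_subset)
      then show "bounded (f ` K)"
        by (rule compact_imp_bounded)
    qed
    \<comment> \<open>Hausdorff covers are sequences, while \<open>\<D>\<close> is merely countable
      and may be finite. Indices that number no interval get the empty set, whose diameter is
      0.\<close>
    define U where "U i = (\<Union>K\<in>{K \<in> \<D>. to_nat_on \<D> K = i}. f ` K)" for i
    have UK: "U (to_nat_on \<D> K) = f ` K" if "K \<in> \<D>" for K
      using that \<D>(1) by (auto simp: U_def)
    have U_cases: "U i = {} \<or> (\<exists>K\<in>\<D>. to_nat_on \<D> K = i \<and> U i = f ` K)" for i
      using UK by (cases "\<exists>K\<in>\<D>. to_nat_on \<D> K = i") (auto simp: U_def)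
    \<comment> \<open>Singletons give the bound \<open>\<delta>\<close> on each diameter, larger
      finite subfamilies the bound on partial sums.\<close>
    have sumK: "C * (\<Sum>K\<in>\<F>. measure lebesgue K) \<le> C * e" if \<F>: "\<F> \<subseteq> \<D>" "finite \<F>" for \<F>
    proof -
      have cb: "\<And>K. K \<in> \<F> \<Longrightarrow> \<exists>c d. K = cbox c d"
          "pairwise (\<lambda>A B. interior A \<inter> interior B = {}) \<F>"
        using \<F> \<D>(2) pairwise_subset[OF \<D>(3)] by blast+
      have "(\<Sum>K\<in>\<F>. measure lebesgue K) = measure lebesgue (\<Union>\<F>)"
        using measure_finite_Union_nonoverlapping_cboxes[OF \<F>(2) cb, of "{}"] by simp
      also have "\<dots> \<le> measure lebesgue (\<Union>\<D>)"
        using \<F> cb(1) \<D>(5)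
        by (intro measure_mono_fmeasurable Union_mono sets.finite_Union) (auto dest!: cb(1))
      finally show ?thesis
        using UD C by (intro mult_left_mono) auto
    qed
    have "hausdorff_measure1_delta \<delta> (f ` T) \<le> (\<Sum>i. ennreal (diameter (U i)))"
      unfolding hausdorff_measure1_delta_def
    proof (rule INF_lower, safe)
      fix x assume "x \<in> T"
      then obtain K where "K \<in> \<D>" "x \<in> K"
        using \<D>(4) by blast
      then show "f x \<in> (\<Union>i. U i)"
        using UK by blast
    next
      fix i
      show "bounded (U i)"
        using U_cases[of i] img by auto
      show "diameter (U i) \<le> \<delta>"
      proof (cases "U i = {}")
        case False
        then obtain K where K: "K \<in> \<D>" "U i = f ` K"
          using U_cases by blast
        then show ?thesis
          using img(2)[of K] sumK[of "{K}"] e by simp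
      qed (use that in simp)
    qed
    also have "\<dots> \<le> ennreal \<epsilon>"
    proof (rule suminf_le_const)
      fix n
      define \<F> where "\<F> = {K \<in> \<D>. to_nat_on \<D> K < n}"
      have inj: "inj_on (to_nat_on \<D>) \<F>"
        using inj_on_to_nat_on[OF \<D>(1)] by (rule inj_on_subset) (auto simp: \<F>_def)
      have fin: "finite \<F>"
        by (rule inj_on_finite[OF inj, of "{..<n}"]) (auto simp: \<F>_def)
      have "(\<Sum>i<n. ennreal (diameter (U i))) = (\<Sum>i\<in>to_nat_on \<D> ` \<F>. ennreal (diameter (U i)))"
      proof (rule sum.mono_neutral_right)
        show "\<forall>i\<in>{..<n} - to_nat_on \<D> ` \<F>. ennreal (diameter (U i)) = 0"
        proof
          fix i assume "i \<in> {..<n} - to_nat_on \<D> ` \<F>"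
          then have "U i = {}"
            using U_cases[of i] by (auto simp: \<F>_def)
          then show "ennreal (diameter (U i)) = 0"
            by simp
        qed
      qed (auto simp: \<F>_def)
      also have "\<dots> = (\<Sum>K\<in>\<F>. ennreal (diameter (f ` K)))"
        using inj UK by (simp add: sum.reindex \<F>_def)
      also have "\<dots> = ennreal (\<Sum>K\<in>\<F>. diameter (f ` K))"
        using img by (intro sum_ennreal diameter_ge_0) (auto simp: \<F>_def)
      also have "\<dots> \<le> ennreal \<epsilon>"
      proof (rule ennreal_leI)
        have "(\<Sum>K\<in>\<F>. diameter (f ` K)) \<le> C * (\<Sum>K\<in>\<F>. measure lebesgue K)"
          unfolding sum_distrib_left using img by (intro sum_mono) (auto simp: \<F>_def)
        also have "\<dots> \<le> C * e"
          using fin by (intro sumK) (auto simp: \<F>_def)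
        finally show "(\<Sum>K\<in>\<F>. diameter (f ` K)) \<le> \<epsilon>"
          using e by linarith
      qed
      finally show "(\<Sum>i<n. ennreal (diameter (U i))) \<le> ennreal \<epsilon>" .
    qed simp
    finally show ?thesis .
  qed
  have "hausdorff_measure1_delta \<delta> (f ` T) = 0" if "\<delta> > 0" for \<delta>
  proof -
    have "hausdorff_measure1_delta \<delta> (f ` T) \<le> 0"
      by (rule ennreal_le_epsilon) (use small[OF that] in auto)
    then show ?thesis
      by simp
  qed
  then show ?thesis
    unfolding hausdorff_measure1_def by (simp add: SUP_eq_const[of _ _ 0] greaterThan_non_empty)
qed

section \<open>Distances to two pins\<close>

text \<open>\<open>emeasure\<close> is 0 by default on nonmeasurable sets. Compactness of
  \<open>E\<close> makes the distance set compact, hence measurable, so that value 0 really means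
  null.\<close>

lemma negligible_pinned_distance_set:
  assumes "compact E" and "emeasure lebesgue (pinned_distance_set y E) = 0"
  shows "negligible (pinned_distance_set y E)"
proof -
  have "pinned_distance_set y E = (\<lambda>x. norm (x - y)) ` E"
    by (auto simp: pinned_distance_set_def)
  then have "compact (pinned_distance_set y E)"
    using assms(1) by (auto intro!: compact_continuous_image continuous_intros)
  then show ?thesis
    using assms(2) by (simp add: negligible_iff_emeasure0 lmeasurable_compact fmeasurableD)
qed

text \<open>This is Pythagoras in the orthogonal frame of \<open>e\<close> and its quarter turn
  \<open>n\<close>; left unnormalised, it is a polynomial identity.\<close>

lemma norm_sq_plane_decomposition:
  fixes z e :: "real^2"
  defines "n \<equiv> vector [- e $ 2, e $ 1]"
  shows "(norm e)\<^sup>2 * (norm z)\<^sup>2 = (z \<bullet> e)\<^sup>2 + (z \<bullet> n)\<^sup>2"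
  unfolding n_def power2_norm_eq_inner inner_vec_def
  by (simp add: sum_2 power2_eq_square algebra_simps)

lemma abs_diff_power2_le:
  fixes x y :: real
  assumes "\<bar>x\<bar> \<le> R" "\<bar>y\<bar> \<le> R"
  shows "\<bar>x\<^sup>2 - y\<^sup>2\<bar> \<le> 2 * R * \<bar>x - y\<bar>"
proof -
  have "\<bar>x\<^sup>2 - y\<^sup>2\<bar> = \<bar>x + y\<bar> * \<bar>x - y\<bar>"
    by (simp add: abs_mult[symmetric] power2_eq_square algebra_simps)
  also have "\<dots> \<le> 2 * R * \<bar>x - y\<bar>"
    using assms by (intro mult_right_mono) auto
  finally show ?thesis .
qed

text \<open>By \<open>expand\<close>, whatever controls the point \<open>\<gamma> t\<close> controls
  \<open>t\<close>. The criterion for two Lipschitz functions is applied once on the line of the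
  pins and locally off it.\<close>

lemma negligible_preimage_curve:
  fixes \<gamma> :: "real \<Rightarrow> real^2"
  assumes \<gamma>: "C-lipschitz_on UNIV \<gamma>" and expand: "\<And>s t. \<bar>t - s\<bar> \<le> norm (\<gamma> t - \<gamma> s)"
    and T: "compact T" and "y \<noteq> y'"
    and neg: "negligible ((\<lambda>t. norm (\<gamma> t - y)) ` T)" "negligible ((\<lambda>t. norm (\<gamma> t - y')) ` T)"
  shows "negligible T"
proof -
  define e where "e = y' - y"
  define n :: "real^2" where "n = vector [- e $ 2, e $ 1]"
  define d where "d = norm e"
  define g where "g t = norm (\<gamma> t - y)" for t
  define g' where "g' t = norm (\<gamma> t - y')" for t
  define v where "v t = (\<gamma> t - y) \<bullet> e" for t
  define w where "w t = (\<gamma> t - y) \<bullet> n" for t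
  \<comment> \<open>\<open>v\<close> is affine in \<open>g\<^sup>2\<close> and \<open>g'\<^sup>2\<close>, and \<open>w\<^sup>2\<close> is a polynomial in \<open>g\<close> and \<open>g'\<close>, so near a point
    with \<open>w \<noteq> 0\<close> the pair \<open>(g, g')\<close> controls the parameter. On \<open>w = 0\<close> it does not, but there
    \<open>\<bar>v\<bar>\<close> is a multiple of \<open>g\<close>, so \<open>(v, w)\<close> is used instead.\<close>
  have d: "d > 0"
    using \<open>y \<noteq> y'\<close> by (simp add: d_def e_def)
  have C: "C \<ge> 0"
    using \<gamma> lipschitz_on_nonneg by blast
  have norm_n: "norm n = d"
    unfolding d_def n_def norm_vec_def L2_set_def by (simp add: sum_2 add.commute)
  have pyth: "d\<^sup>2 * (norm z)\<^sup>2 = (z \<bullet> e)\<^sup>2 + (z \<bullet> n)\<^sup>2" for z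
    unfolding d_def n_def by (rule norm_sq_plane_decomposition)
  have inner_lip: "\<bar>(\<gamma> t - y) \<bullet> x - (\<gamma> s - y) \<bullet> x\<bar> \<le> C * norm x * \<bar>t - s\<bar>" for s t x
  proof -
    have "\<bar>(\<gamma> t - y) \<bullet> x - (\<gamma> s - y) \<bullet> x\<bar> = \<bar>(\<gamma> t - \<gamma> s) \<bullet> x\<bar>"
      by (simp add: inner_diff_left)
    also have "\<dots> \<le> norm (\<gamma> t - \<gamma> s) * norm x"
      by (rule Cauchy_Schwarz_ineq2)
    also have "\<dots> \<le> (C * \<bar>t - s\<bar>) * norm x"
      using lipschitz_on_normD[OF \<gamma>, of t s] by (intro mult_right_mono) auto
    finally show ?thesis
      by (simp add: mult_ac)
  qed
  have v_lip: "(C * d)-lipschitz_on A v" for A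
    using inner_lip[of _ e] C d by (intro lipschitz_onI) (auto simp: v_def d_def dist_real_def)
  have w_lip: "(C * d)-lipschitz_on A w" for A
    using inner_lip[of _ n] C d norm_n by (intro lipschitz_onI) (auto simp: w_def dist_real_def)
  have dist_lip: "C-lipschitz_on A (\<lambda>t. norm (\<gamma> t - z))" for A z
  proof (rule lipschitz_onI)
    fix s t
    have "dist (norm (\<gamma> s - z)) (norm (\<gamma> t - z)) \<le> norm ((\<gamma> s - z) - (\<gamma> t - z))"
      unfolding dist_real_def by (rule norm_triangle_ineq3)
    then show "dist (norm (\<gamma> s - z)) (norm (\<gamma> t - z)) \<le> C * dist s t"
      using lipschitz_on_normD[OF \<gamma>, of s t] by (simp add: dist_norm)
  qed (rule C)
  have g_lip: "C-lipschitz_on A g" "C-lipschitz_on A g'" for A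
    using dist_lip[of A y] dist_lip[of A y'] by (simp_all add: g_def[abs_def] g'_def[abs_def])
  \<comment> \<open>\<open>v\<close> and \<open>w\<close> are \<open>d\<close> times the Cartesian
    coordinates along and across the line of the pins, so together they control the parameter
    everywhere.\<close>
  have expand_vw: "\<bar>t - s\<bar> \<le> (1 / d) * (\<bar>v t - v s\<bar> + \<bar>w t - w s\<bar>)" for s t
  proof -
    have "v t - v s = (\<gamma> t - \<gamma> s) \<bullet> e" "w t - w s = (\<gamma> t - \<gamma> s) \<bullet> n"
      by (simp_all add: v_def w_def inner_diff_left)
    then have "d * norm (\<gamma> t - \<gamma> s) = sqrt ((v t - v s)\<^sup>2 + (w t - w s)\<^sup>2)"
      using pyth[of "\<gamma> t - \<gamma> s"] d
      by (metis norm_ge_zero power_mult_distrib real_sqrt_unique mult_nonneg_nonneg less_imp_le)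
    also have "\<dots> \<le> \<bar>v t - v s\<bar> + \<bar>w t - w s\<bar>"
      by (rule sqrt_sum_squares_le_sum_abs)
    finally have "norm (\<gamma> t - \<gamma> s) \<le> (1 / d) * (\<bar>v t - v s\<bar> + \<bar>w t - w s\<bar>)"
      using d by (simp add: field_simps)
    then show ?thesis
      using expand[of t s] by linarith
  qed
  \<comment> \<open>Law of cosines for the triangle formed by \<open>y\<close>, \<open>y'\<close>
    and \<open>\<gamma> t\<close>.\<close>
  have v_eq: "2 * v t = (g t)\<^sup>2 - (g' t)\<^sup>2 + d\<^sup>2" for t
    unfolding v_def g_def g'_def d_def e_def power2_norm_eq_inner
    by (simp add: inner_diff_left inner_diff_right inner_commute)
  have w_eq: "(w t)\<^sup>2 = d\<^sup>2 * (g t)\<^sup>2 - (v t)\<^sup>2" for t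
    using pyth[of "\<gamma> t - y"] by (simp add: v_def w_def g_def)
  have v_le: "\<bar>v t\<bar> \<le> d * g t" for t
    using Cauchy_Schwarz_ineq2[of "\<gamma> t - y" e] by (simp add: v_def g_def d_def mult.commute)

  define T0 where "T0 = {t \<in> T. w t = 0}"
  have w_cont: "continuous_on A w" for A
    using w_lip lipschitz_on_continuous_on by blast
  have "negligible T0"
  proof -
    obtain a b where ab: "T \<subseteq> {a..b}"
      using compact_imp_bounded[OF T] bounded_subset_cbox_symmetric by (metis box_real(2))
    have "closed (w -` {0})"
      using w_cont by (intro closed_vimage) auto
    moreover have "T0 = T \<inter> w -` {0}"
      by (auto simp: T0_def)
    ultimately have "compact T0"
      using T by (simp add: compact_Int_closed)
    \<comment> \<open>On the line \<open>v\<close> equals \<open>d * g\<close> up to sign, so its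
      values lie in two scaled copies of a null set.\<close>
    moreover have "negligible (v ` T0)"
    proof -
      have gT: "negligible (g ` T)"
        using neg(1) by (simp add: g_def[abs_def])
      have "negligible ((\<lambda>x. d * x) ` g ` T)" "negligible ((\<lambda>x. - d * x) ` g ` T)"
        by (rule negligible_differentiable_image_negligible[OF _ gT]; auto intro!: derivative_intros)+
      moreover have "v ` T0 \<subseteq> (\<lambda>x. d * x) ` g ` T \<union> (\<lambda>x. - d * x) ` g ` T"
      proof
        fix x assume "x \<in> v ` T0"
        then obtain t where t: "t \<in> T" "w t = 0" "x = v t"
          by (auto simp: T0_def)
        then have "(v t)\<^sup>2 = (d * g t)\<^sup>2"
          using w_eq[of t] by (simp add: power_mult_distrib)
        then have "x = d * g t \<or> x = - d * g t"
          using t by (simp add: power2_eq_iff)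
        then show "x \<in> (\<lambda>x. d * x) ` g ` T \<union> (\<lambda>x. - d * x) ` g ` T"
          using t by auto
      qed
      ultimately show ?thesis
        by (meson negligible_Un negligible_subset)
    qed
    moreover have "negligible (w ` T0)"
      by (rule negligible_subset[of "{0}"]) (auto simp: T0_def)
    ultimately show ?thesis
      using expand_vw d ab
      by (intro negligible_if_lipschitz_images_negligible[OF v_lip w_lip, of T0 a b "1 / d"])
        (auto simp: T0_def lmeasurable_compact fmeasurableD)
  qed
  \<comment> \<open>The constant \<open>M\<close> below blows up as \<open>w\<close> tends to 0, so
    the argument is local: it suffices that each point has a null relative neighbourhood.\<close>
  moreover have "negligible {t \<in> T. w t \<noteq> 0}"
    unfolding locally_negligible_alt[of "{t \<in> T. w t \<noteq> 0}"]
  proof (intro ballI)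
    fix t0 assume t0: "t0 \<in> {t \<in> T. w t \<noteq> 0}"
    define m where "m = \<bar>w t0\<bar>"
    have m: "m > 0"
      using t0 by (simp add: m_def)
    \<comment> \<open>The cap 1 keeps both distances bounded near \<open>t0\<close>; the other keeps
      \<open>w\<close> within \<open>m / 2\<close> of \<open>w t0\<close>.\<close>
    define r where "r = min 1 (m / (2 * (C * d + 1)))"
    have Cd: "C * d \<ge> 0"
      using C d by simp
    have r: "r > 0" "r \<le> 1" "C * d * r \<le> m / 2"
    proof -
      show "r > 0" "r \<le> 1"
        using m Cd by (auto simp: r_def)
      have "C * d * r \<le> C * d * (m / (2 * (C * d + 1)))"
        using Cd by (intro mult_left_mono) (auto simp: r_def)
      also have "\<dots> \<le> m / 2"
        using m Cd by (simp add: field_simps)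
      finally show "C * d * r \<le> m / 2" .
    qed
    define J where "J = {t0 - r..t0 + r}"
    define R where "R = g t0 + g' t0 + C"
    have near: "\<bar>t - t0\<bar> \<le> r" if "t \<in> J" for t
      using that by (auto simp: J_def)
    have gR: "\<bar>g t\<bar> \<le> R" "\<bar>g' t\<bar> \<le> R" if "t \<in> J" for t
    proof -
      have "C * \<bar>t - t0\<bar> \<le> C"
        using near[OF that] r C mult_left_mono[of "\<bar>t - t0\<bar>" 1 C] by simp
      moreover have "\<bar>g t - g t0\<bar> \<le> C * \<bar>t - t0\<bar>" "\<bar>g' t - g' t0\<bar> \<le> C * \<bar>t - t0\<bar>"
        using lipschitz_on_normD[OF g_lip(1)[of UNIV], of t t0]
          lipschitz_on_normD[OF g_lip(2)[of UNIV], of t t0] by auto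
      moreover have "g t \<ge> 0" "g' t \<ge> 0" "g t0 \<ge> 0" "g' t0 \<ge> 0"
        by (auto simp: g_def g'_def)
      ultimately show "\<bar>g t\<bar> \<le> R" "\<bar>g' t\<bar> \<le> R"
        unfolding R_def by linarith+
    qed
    have "t0 \<in> J"
      using r by (simp add: J_def)
    then have R: "R \<ge> 0"
      using gR(1) by fastforce
    have w_near: "\<bar>w t - w t0\<bar> \<le> m / 2" if "t \<in> J" for t
    proof -
      have "\<bar>w t - w t0\<bar> \<le> C * d * \<bar>t - t0\<bar>"
        using lipschitz_on_normD[OF w_lip[of UNIV], of t t0] by auto
      also have "\<dots> \<le> C * d * r"
        using near[OF that] Cd by (intro mult_left_mono) auto
      finally show ?thesis
        using r by linarith
    qed
    \<comment> \<open>The first summand bounds the variation of \<open>v\<close>, the quotient that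
      of \<open>w\<close>, and \<open>1 / d\<close> comes from \<open>expand_vw\<close>.\<close>
    define M where "M = (1 / d) * (R + (2 * R * d\<^sup>2 + 2 * (R * d) * R) / m)"
    have sep: "\<bar>t - s\<bar> \<le> M * (\<bar>g t - g s\<bar> + \<bar>g' t - g' s\<bar>)" if st: "s \<in> J" "t \<in> J" for s t
    proof -
      define D where "D = \<bar>g t - g s\<bar> + \<bar>g' t - g' s\<bar>"
      have sq: "\<bar>(g t)\<^sup>2 - (g s)\<^sup>2\<bar> \<le> 2 * R * \<bar>g t - g s\<bar>" "\<bar>(g' t)\<^sup>2 - (g' s)\<^sup>2\<bar> \<le> 2 * R * \<bar>g' t - g' s\<bar>"
        using gR st by (auto intro: abs_diff_power2_le)
      then have vD: "\<bar>v t - v s\<bar> \<le> R * D"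
        using v_eq[of t] v_eq[of s] unfolding D_def by (simp add: distrib_left)
      have "\<bar>v t\<bar> \<le> R * d" "\<bar>v s\<bar> \<le> R * d"
        using v_le[of t] v_le[of s] gR(1)[OF st(1)] gR(1)[OF st(2)] d
        by (smt (verit) mult.commute mult_left_mono)+
      then have "\<bar>(v t)\<^sup>2 - (v s)\<^sup>2\<bar> \<le> 2 * (R * d) * \<bar>v t - v s\<bar>"
        by (rule abs_diff_power2_le)
      also have "\<dots> \<le> 2 * (R * d) * (R * D)"
        using vD R d by (intro mult_left_mono) auto
      finally have v2: "\<bar>(v t)\<^sup>2 - (v s)\<^sup>2\<bar> \<le> 2 * (R * d) * R * D"
        by (simp add: mult_ac)
      have "\<bar>(g t)\<^sup>2 - (g s)\<^sup>2\<bar> \<le> 2 * R * D"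
        by (rule order_trans[OF sq(1) mult_left_mono]) (use R in \<open>auto simp: D_def\<close>)
      then have "d\<^sup>2 * \<bar>(g t)\<^sup>2 - (g s)\<^sup>2\<bar> \<le> d\<^sup>2 * (2 * R * D)"
        by (intro mult_left_mono) auto
      moreover have "(w t)\<^sup>2 - (w s)\<^sup>2 = d\<^sup>2 * ((g t)\<^sup>2 - (g s)\<^sup>2) - ((v t)\<^sup>2 - (v s)\<^sup>2)"
        by (simp add: w_eq algebra_simps)
      then have "\<bar>(w t)\<^sup>2 - (w s)\<^sup>2\<bar> \<le> d\<^sup>2 * \<bar>(g t)\<^sup>2 - (g s)\<^sup>2\<bar> + \<bar>(v t)\<^sup>2 - (v s)\<^sup>2\<bar>"
        using abs_triangle_ineq4[of "d\<^sup>2 * ((g t)\<^sup>2 - (g s)\<^sup>2)" "(v t)\<^sup>2 - (v s)\<^sup>2"] by (simp add: abs_mult)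
      ultimately have w2: "\<bar>(w t)\<^sup>2 - (w s)\<^sup>2\<bar> \<le> (2 * R * d\<^sup>2 + 2 * (R * d) * R) * D"
        using v2 by (simp add: algebra_simps)
      \<comment> \<open>Both values share the sign of \<open>w t0\<close>, so their sum stays away
        from 0 and control of the square of \<open>w\<close> becomes control of
        \<open>w\<close>.\<close>
      have "m \<le> \<bar>w t + w s\<bar>"
        using w_near[OF st(1)] w_near[OF st(2)] unfolding m_def by linarith
      then have "m * \<bar>w t - w s\<bar> \<le> \<bar>w t + w s\<bar> * \<bar>w t - w s\<bar>"
        by (intro mult_right_mono) auto
      also have "\<dots> = \<bar>(w t)\<^sup>2 - (w s)\<^sup>2\<bar>"
        by (simp add: abs_mult[symmetric] power2_eq_square algebra_simps)
      finally have wD: "\<bar>w t - w s\<bar> \<le> (2 * R * d\<^sup>2 + 2 * (R * d) * R) / m * D"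
        using w2 m by (simp add: field_simps)
      have "\<bar>t - s\<bar> \<le> (1 / d) * (\<bar>v t - v s\<bar> + \<bar>w t - w s\<bar>)"
        by (rule expand_vw)
      also have "\<dots> \<le> (1 / d) * (R * D + (2 * R * d\<^sup>2 + 2 * (R * d) * R) / m * D)"
        using vD wD d by (intro mult_left_mono add_mono) auto
      also have "\<dots> = M * D"
        by (simp only: M_def distrib_right mult.assoc)
      finally show ?thesis
        by (simp add: D_def)
    qed
    have "negligible (T \<inter> J)"
    proof (rule negligible_if_lipschitz_images_negligible[OF g_lip])
      show "T \<inter> J \<in> sets lebesgue"
        using T by (auto simp: J_def lmeasurable_compact fmeasurableD)
      show "T \<inter> J \<subseteq> {t0 - r..t0 + r}"
        by (auto simp: J_def)
      show "negligible (g ` (T \<inter> J))" "negligible (g' ` (T \<inter> J))"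
        using neg unfolding g_def[abs_def] g'_def[abs_def] by (blast intro: negligible_subset)+
      show "M \<ge> 0"
        using R d m by (simp add: M_def)
    qed (use sep in \<open>auto simp: J_def\<close>)
    moreover have "{t \<in> T. w t \<noteq> 0} \<inter> {t0 - r<..<t0 + r} \<subseteq> T \<inter> J"
      by (auto simp: J_def)
    ultimately have "negligible ({t \<in> T. w t \<noteq> 0} \<inter> {t0 - r<..<t0 + r})"
      by (rule negligible_subset)
    then show "\<exists>U. openin (top_of_set {t \<in> T. w t \<noteq> 0}) U \<and> t0 \<in> U \<and> negligible U"
      using t0 r by (intro exI[of _ "{t \<in> T. w t \<noteq> 0} \<inter> {t0 - r<..<t0 + r}"]) auto
  qed
  moreover have "T = T0 \<union> {t \<in> T. w t \<noteq> 0}"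
    by (auto simp: T0_def)
  ultimately show ?thesis
    by (metis negligible_Un)
qed

section \<open>Passage to Lipschitz graphs\<close>

theorem corollary2p8:
  fixes E :: "(real ^ 2) set"
  assumes "compact E"
    and "\<exists>y y'. y \<noteq> y' \<and> emeasure lebesgue (pinned_distance_set y E) = 0
                      \<and> emeasure lebesgue (pinned_distance_set y' E) = 0"
  shows "purely_1_unrectifiable E"
  unfolding purely_1_unrectifiable_def
proof (intro allI impI)
  fix Z :: "(real ^ 2) set"
  assume "lipschitz_graph Z"
  then obtain F :: "real \<Rightarrow> real" and L w1 w2 where F: "L-lipschitz_on UNIV F"
    and w: "norm w1 = 1" "norm w2 = 1" "w1 \<bullet> w2 = 0"
    and Z: "Z = {x *\<^sub>R w1 + F x *\<^sub>R w2 | x. x \<in> UNIV}"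
    unfolding lipschitz_graph_def by blast
  obtain y y' where y: "y \<noteq> y'" "emeasure lebesgue (pinned_distance_set y E) = 0"
      "emeasure lebesgue (pinned_distance_set y' E) = 0"
    using assms(2) by blast
  define \<gamma> where "\<gamma> x = x *\<^sub>R w1 + F x *\<^sub>R w2" for x
  define T where "T = \<gamma> -` E"
  have \<gamma>_lip: "(1 + L)-lipschitz_on UNIV \<gamma>"
  proof (rule lipschitz_onI)
    fix s t
    have "dist (\<gamma> s) (\<gamma> t) = norm ((s - t) *\<^sub>R w1 + (F s - F t) *\<^sub>R w2)"
      by (simp add: \<gamma>_def dist_norm algebra_simps)
    also have "\<dots> \<le> \<bar>s - t\<bar> + \<bar>F s - F t\<bar>"
      using norm_triangle_ineq[of "(s - t) *\<^sub>R w1" "(F s - F t) *\<^sub>R w2"] w by simp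
    also have "\<dots> \<le> (1 + L) * dist s t"
      using lipschitz_onD[OF F, of s t] by (simp add: dist_real_def algebra_simps)
    finally show "dist (\<gamma> s) (\<gamma> t) \<le> (1 + L) * dist s t" .
  qed (use lipschitz_on_nonneg[OF F] in simp)
  have "w1 \<bullet> w1 = 1" "w2 \<bullet> w1 = 0"
    using w by (simp_all add: norm_eq_1 inner_commute)
  \<comment> \<open>Projection onto \<open>w1\<close> recovers the parameter; this yields both
    \<open>expand\<close> and the boundedness of \<open>T\<close>.\<close>
  then have inner_w1: "\<gamma> t \<bullet> w1 = t" for t
    by (simp add: \<gamma>_def inner_add_left)
  have expand: "\<bar>t - s\<bar> \<le> norm (\<gamma> t - \<gamma> s)" for s t
    using Cauchy_Schwarz_ineq2[of "\<gamma> t - \<gamma> s" w1] w by (simp add: inner_diff_left inner_w1)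
  have "T \<subseteq> (\<lambda>x. x \<bullet> w1) ` E"
  proof
    fix t assume "t \<in> T"
    then show "t \<in> (\<lambda>x. x \<bullet> w1) ` E"
      by (intro image_eqI[of _ _ "\<gamma> t"]) (simp_all add: T_def inner_w1)
  qed
  moreover have "compact ((\<lambda>x. x \<bullet> w1) ` E)"
    using assms(1) by (intro compact_continuous_image continuous_intros)
  ultimately have "bounded T"
    using bounded_subset compact_imp_bounded by blast
  moreover have "closed T"
    unfolding T_def using lipschitz_on_continuous_on[OF \<gamma>_lip] compact_imp_closed[OF assms(1)]
    by (intro closed_vimage)
  ultimately have T: "compact T"
    by (simp add: compact_eq_bounded_closed)
  obtain a b where ab: "T \<subseteq> {a..b}"
    using \<open>bounded T\<close> bounded_subset_cbox_symmetric by (metis box_real(2))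
  have "negligible ((\<lambda>t. norm (\<gamma> t - z)) ` T)" if "emeasure lebesgue (pinned_distance_set z E) = 0" for z
    by (rule negligible_subset[OF negligible_pinned_distance_set[OF assms(1) that]])
      (auto simp: T_def pinned_distance_set_def)
  then have "negligible T"
    using y by (intro negligible_preimage_curve[OF \<gamma>_lip expand T y(1)])
  moreover have "E \<inter> Z = \<gamma> ` T"
    by (auto simp: Z T_def \<gamma>_def)
  ultimately show "hausdorff_measure1 (E \<inter> Z) = 0"
    using hausdorff_measure1_lipschitz_image_eq_0[OF \<gamma>_lip _ ab] by simp
qed

end
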